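(* Let $m\ge 2$, $n\ge 1$, and let $(\mathbf{A}^{(1)},\dots,\mathbf{A}^{(m)})$ be an uncorrelated $m$-tuple of order $m$ cubic complex hypermatrices of side length $n$. For $0\le k<n$ let $\mathbf{P}_k$ be the outer product $$\mathbf{P}_k=\mathrm{Prod}_{\boldsymbol{\Delta}^{(k)}}(\mathbf{A}^{(1)},\dots,\mathbf{A}^{(m)}).$$ Let $\mathbf{x}^{(0)},\dots,\mathbf{x}^{(m-1)}$ and $\mathbf{y}^{(0)},\dots,\mathbf{y}^{(m-1)}$ be vectors in $\mathbb{C}^{n\times 1\times\cdots\times 1}$, and write $y^{(j)}_k$ for the $k$-th entry of $\mathbf{y}^{(j)}$. If $$\forall\, 0\le k<n,\qquad \prod_{0\le j<m}y_k^{(j)}=\mathrm{Prod}_{\mathbf{P}_k}\Big((\mathbf{x}^{(m-1)})^{\top^{(m-1)}},\dots,(\mathbf{x}^{(j)})^{\top^{j}},\dots,(\mathbf{x}^{(0)})^{\top^{0}}\Big),$$ then $$\mathrm{Prod}\Big((\mathbf{y}^{(m-1)})^{\top^{(m-1)}},\dots,(\mathbf{y}^{(0)})^{\top^{0}}\Big)=\mathrm{Prod}\Big((\mathbf{x}^{(m-1)})^{\top^{(m-1)}},\dots,(\mathbf{x}^{(0)})^{\top^{0}}\Big),$$ i.e. $\sum_{0\le k<n}\prod_{0\le j<m}y^{(j)}_k=\sum_{0\le k<n}\prod_{0\le j<m}x^{(j)}_k$. In particular, for $m=2$: if $\mathbf{A}^{(1)},\mathbf{A}^{(2)}\in\mathbb{C}^{n\times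 n}$ are an inverse pair, $\mathbf{x}^{(0)},\mathbf{x}^{(1)},\mathbf{y}^{(0)},\mathbf{y}^{(1)}\in\mathbb{C}^{n\times 1}$ and $y^{(1)}_k y^{(0)}_k=\mathrm{Prod}_{\mathbf{P}_k}((\mathbf{x}^{(1)})^\top,\mathbf{x}^{(0)})$ for all $0\le k<n$, then $\mathrm{Prod}((\mathbf{y}^{(1)})^\top,\mathbf{y}^{(0)})=\mathrm{Prod}((\mathbf{x}^{(1)})^\top,\mathbf{x}^{(0)})$.
   Context: All indices start at $0$. A cubic order $m$ hypermatrix of side length $n$ is an array $\mathbf{A}=(a_{i_1\cdots i_m})_{0\le i_1,\dots,i_m<n}$ of complex numbers. The Bhattacharya-Mesner (BM) product of $m$ such hypermatrices is the order $m$ hypermatrix with entries $$[\mathrm{Prod}(\mathbf{A}^{(1)},\dots,\mathbf{A}^{(m)})]_{i_1,\dots,i_m}=\sum_{0\le j<n}a^{(1)}_{i_1\,j\,i_3\cdots i_m}\cdots a^{(t)}_{i_1\cdots i_t\,j\,i_{t+2}\cdots i_m}\cdots a^{(m)}_{j\,i_2\cdots i_m},$$ where the $t$-th factor has its index $i_{t+1}$ replaced by $j$ for $t<m$, and the $m$-th factor has $i_1$ replaced by $j$. For $m=2$ this is the matrix product. The Kronecker delta $\boldsymbol{\Delta}$ has entry $1$ where $i_1=\cdots=i_m$ and $0$ elsewhere. The tuple $(\mathbf{A}^{(1)},\dots,\mathbf{A}^{(m)})$ is uncorrelated if $\mathrm{Prod}(\mathbf{A}^{(1)},\dots,\mathbf{A}^{(m)})=\boldsymbol{\Delta}$.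 The outer product $\mathrm{Prod}_{\boldsymbol{\Delta}^{(k)}}(\mathbf{A}^{(1)},\dots,\mathbf{A}^{(m)})$ is the order $m$ hypermatrix whose $(i_1,\dots,i_m)$ entry is the single summand $j=k$ of the sum above. For an order $m$ cubic hypermatrix $\mathbf{P}$ of side length $n$ and column vectors $\mathbf{x}^{(0)},\dots,\mathbf{x}^{(m-1)}\in\mathbb{C}^{n\times1\times\cdots\times1}$, the expression $\mathrm{Prod}_{\mathbf{P}}((\mathbf{x}^{(m-1)})^{\top^{(m-1)}},\dots,(\mathbf{x}^{(0)})^{\top^0})$ denotes the multilinear form $$\sum_{0\le i_1,\dots,i_m<n}p_{i_1\cdots i_m}\,x^{(m-1)}_{i_1}x^{(m-2)}_{i_2}\cdots x^{(0)}_{i_m},$$ and $\mathrm{Prod}((\mathbf{x}^{(m-1)})^{\top^{(m-1)}},\dots,(\mathbf{x}^{(0)})^{\top^0})$ (no background hypermatrix) is this form for $\mathbf{P}=\boldsymbol{\Delta}$, i.e. $\sum_{0\le k<n}\prod_j x^{(j)}_k$. *)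

theory Defs
  imports Complex_Main "Jordan_Normal_Form.Matrix"
begin

text \<open>
  An order \<open>m\<close> cubic hypermatrix of side length \<open>n\<close> is a function on index lists
  \<open>[i\<^sub>1, \<dots>, i\<^sub>m]\<close>; only its values on \<open>indices m n\<close> are meaningful.  List positions count
  from 0, so the index \<open>i\<^sub>s\<close> sits at position \<open>s - 1\<close>.
\<close>

type_synonym hypermatrix = "nat list \<Rightarrow> complex"

definition indices :: "nat \<Rightarrow> nat \<Rightarrow> nat list set" where
  "indices m n = {ix. length ix = m \<and> set ix \<subseteq> {..<n}}"

definition kronecker_delta :: hypermatrix where
  "kronecker_delta ix = (if \<forall>i\<in>set ix. \<forall>j\<in>set ix. i = j then 1 else 0)"

text \<open>
  A tuple of factors is a family \<open>A 1, \<dots>, A m\<close>.  In factor \<open>t < m\<close> the index \<open>i\<^bsub>t+1\<^esub>\<close>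
  (list position \<open>t\<close>) is replaced by \<open>k\<close>; in factor \<open>m\<close> the index \<open>i\<^sub>1\<close> (position 0) is.
\<close>

definition outer_prod :: "nat \<Rightarrow> (nat \<Rightarrow> hypermatrix) \<Rightarrow> nat \<Rightarrow> hypermatrix" where
  "outer_prod m A k ix = (\<Prod>t = 1..m. A t (ix[(if t < m then t else 0) := k]))"

definition BM_prod :: "nat \<Rightarrow> nat \<Rightarrow> (nat \<Rightarrow> hypermatrix) \<Rightarrow> hypermatrix" where
  "BM_prod m n A ix = (\<Sum>j<n. outer_prod m A j ix)"

definition uncorrelated :: "nat \<Rightarrow> nat \<Rightarrow> (nat \<Rightarrow> hypermatrix) \<Rightarrow> bool" where
  "uncorrelated m n A \<longleftrightarrow> (\<forall>ix\<in>indices m n. BM_prod m n A ix = kronecker_delta ix)"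

text \<open>
  The multilinear form with background \<open>P\<close>; the vectors enter in reverse order, i.e. \<open>i\<^sub>1\<close> is
  the index of \<open>x (m - 1)\<close> and \<open>i\<^sub>m\<close> that of \<open>x 0\<close>.
\<close>

definition form_prod ::
    "nat \<Rightarrow> nat \<Rightarrow> hypermatrix \<Rightarrow> (nat \<Rightarrow> complex vec) \<Rightarrow> complex" where
  "form_prod m n P x = (\<Sum>ix\<in>indices m n. P ix * (\<Prod>s<m. x (m - 1 - s) $ (ix ! s)))"

definition hypermatrix_of_mat :: "complex mat \<Rightarrow> hypermatrix" where
  "hypermatrix_of_mat M ix = M $$ (ix ! 0, ix ! 1)"

lemma BM_prod_2_eq_matrix_product:
  assumes "A 1 \<in> carrier_mat n n" "A 2 \<in> carrier_mat n n" "i < n" "j < n"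
  shows "BM_prod 2 n (\<lambda>t. hypermatrix_of_mat (A t)) [i, j] = (A 1 * A 2) $$ (i, j)"
proof -
  have "{1..2::nat} = {1, 2}" by auto
  then show ?thesis
    using assms
    by (auto simp: BM_prod_def outer_prod_def hypermatrix_of_mat_def scalar_prod_def
        lessThan_atLeast0 intro!: sum.cong)
qed

end

theory Submission
  imports Defs
begin

text \<open>
  A multilinear form depends linearly on its background hypermatrix, and the BM product is the
  sum of the outer products \<open>P\<^sub>k\<close>.  Summing the hypothesis over \<open>k\<close> therefore turns its right-hand
  sides into the single form with background \<open>Prod(A\<^sup>1, \<dots>, A\<^sup>m)\<close>
  (\<open>sum_form_prod_outer_prod\<close>); the tuple being uncorrelated, this background is \<open>\<Delta>\<close>.  The left-hand
  sides add up to the form of \<open>\<Delta>\<close> at \<open>y\<close>, because \<open>\<Delta>\<close> is supported on the diagonal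
  (\<open>form_prod_kronecker_delta\<close>).  The matrix case is the instance \<open>m = 2\<close>, where uncorrelated
  pairs are the pairs of matrices whose product is the identity.
\<close>

lemma finite_indices: "finite (indices m n)"
  using finite_lists_length_eq[of "{..<n}" m] by (simp add: indices_def conj_commute)

lemma sum_form_prod_outer_prod:
  "(\<Sum>k<n. form_prod m n (outer_prod m A k) x) = form_prod m n (BM_prod m n A) x"
  unfolding form_prod_def BM_prod_def
  by (subst sum.swap) (simp add: sum_distrib_right)

lemma form_prod_BM_prod_uncorrelated:
  assumes "uncorrelated m n A"
  shows "form_prod m n (BM_prod m n A) x = form_prod m n kronecker_delta x"
  using assms by (simp add: form_prod_def uncorrelated_def)

text \<open>
  Positive order makes the diagonal entries correspond one-to-one to \<open>k < n\<close>: for \<open>m = 0\<close> all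
  lists \<open>replicate m k\<close> would collapse to the empty list.
\<close>

lemma form_prod_kronecker_delta:
  assumes "0 < m"
  shows "form_prod m n kronecker_delta x = (\<Sum>k<n. \<Prod>j<m. x j $ k)"
proof -
  let ?diagonal = "replicate m ` {..<n}"
  have on_diagonal: "ix \<in> ?diagonal"
    if ix: "ix \<in> indices m n" and nz: "kronecker_delta ix \<noteq> 0" for ix
  proof -
    have const: "\<forall>i\<in>set ix. \<forall>j\<in>set ix. i = j"
      using nz unfolding kronecker_delta_def by meson
    have len: "length ix = m" and sub: "set ix \<subseteq> {..<n}"
      using ix by (auto simp: indices_def)
    have hd: "hd ix \<in> set ix"
      using len assms by auto
    then have "ix = replicate m (hd ix)"
      using const len by (intro replicate_eqI) blast+
    then show ?thesis
      using hd sub by blast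
  qed
  have inj: "inj_on (replicate m) {..<n}"
    using assms by (auto simp: inj_on_def)
  have "form_prod m n kronecker_delta x =
      (\<Sum>ix\<in>?diagonal. kronecker_delta ix * (\<Prod>s<m. x (m - 1 - s) $ (ix ! s)))"
    unfolding form_prod_def
  proof (rule sum.mono_neutral_right[OF finite_indices])
    show "?diagonal \<subseteq> indices m n"
      by (auto simp: indices_def)
  qed (use on_diagonal in auto)
  also have "\<dots> = (\<Sum>k<n. \<Prod>s<m. x (m - 1 - s) $ k)"
    by (simp add: sum.reindex[OF inj] kronecker_delta_def)
  also have "\<dots> = (\<Sum>k<n. \<Prod>j<m. x j $ k)"
    by (simp add: prod.nat_diff_reindex[of "\<lambda>j. x j $ _" m])
  finally show ?thesis .
qed

lemma uncorrelated_preserves_delta_form: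
  assumes "0 < m" and "uncorrelated m n A"
    and "\<And>k. k < n \<Longrightarrow> (\<Prod>j<m. y j $ k) = form_prod m n (outer_prod m A k) x"
  shows "form_prod m n kronecker_delta y = form_prod m n kronecker_delta x"
proof -
  have "form_prod m n kronecker_delta y = (\<Sum>k<n. form_prod m n (outer_prod m A k) x)"
    using assms by (simp add: form_prod_kronecker_delta)
  also have "\<dots> = form_prod m n kronecker_delta x"
    using assms(2) by (simp add: sum_form_prod_outer_prod form_prod_BM_prod_uncorrelated)
  finally show ?thesis .
qed

lemma uncorrelated_hypermatrix_of_inverse_pair:
  assumes A: "A 1 \<in> carrier_mat n n" "A 2 \<in> carrier_mat n n" and inv: "inverts_mat (A 1) (A 2)"
  shows "uncorrelated 2 n (\<lambda>t. hypermatrix_of_mat (A t))"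
  unfolding uncorrelated_def
proof
  fix ix assume "ix \<in> indices 2 n"
  then obtain i j where ix: "ix = [i, j]" and ij: "i < n" "j < n"
    by (auto simp: indices_def numeral_2_eq_2 length_Suc_conv)
  have "A 1 * A 2 = 1\<^sub>m n"
    using inv A by (simp add: inverts_mat_def)
  then have "BM_prod 2 n (\<lambda>t. hypermatrix_of_mat (A t)) [i, j] = (if i = j then 1 else 0)"
    using ij by (simp only: BM_prod_2_eq_matrix_product[of A n i j, OF A ij] index_one_mat)
  moreover have "kronecker_delta [i, j] = (if i = j then 1 else 0)"
    by (auto simp: kronecker_delta_def)
  ultimately show "BM_prod 2 n (\<lambda>t. hypermatrix_of_mat (A t)) ix = kronecker_delta ix"
    by (simp only: ix)
qed

theorem proposition1:
  shows "(\<forall>(m::nat) (n::nat) (A :: nat \<Rightarrow> hypermatrix)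
            (x :: nat \<Rightarrow> complex vec) (y :: nat \<Rightarrow> complex vec).
            2 \<le> m \<longrightarrow> 1 \<le> n \<longrightarrow> uncorrelated m n A \<longrightarrow>
            (\<forall>j<m. x j \<in> carrier_vec n) \<longrightarrow> (\<forall>j<m. y j \<in> carrier_vec n) \<longrightarrow>
            (\<forall>k<n. (\<Prod>j<m. y j $ k) = form_prod m n (outer_prod m A k) x) \<longrightarrow>
            form_prod m n kronecker_delta y = form_prod m n kronecker_delta x \<and>
            (\<Sum>k<n. \<Prod>j<m. y j $ k) = (\<Sum>k<n. \<Prod>j<m. x j $ k)) \<and>
         (\<forall>(n::nat) (A :: nat \<Rightarrow> complex mat)
            (x :: nat \<Rightarrow> complex vec) (y :: nat \<Rightarrow> complex vec).
            1 \<le> n \<longrightarrow> A 1 \<in> carrier_mat n n \<longrightarrow> A 2 \<in> carrier_mat n n \<longrightarrow>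
            inverts_mat (A 1) (A 2) \<longrightarrow> inverts_mat (A 2) (A 1) \<longrightarrow>
            (\<forall>j<2. x j \<in> carrier_vec n) \<longrightarrow> (\<forall>j<2. y j \<in> carrier_vec n) \<longrightarrow>
            (\<forall>k<n. y 1 $ k * y 0 $ k =
               form_prod 2 n (outer_prod 2 (\<lambda>t. hypermatrix_of_mat (A t)) k) x) \<longrightarrow>
            form_prod 2 n kronecker_delta y = form_prod 2 n kronecker_delta x)"
proof (intro conjI allI impI)
  fix m n :: nat and A :: "nat \<Rightarrow> hypermatrix" and x y :: "nat \<Rightarrow> complex vec"
  assume m: "2 \<le> m" and A: "uncorrelated m n A"
    and y: "\<forall>k<n. (\<Prod>j<m. y j $ k) = form_prod m n (outer_prod m A k) x"
  show forms: "form_prod m n kronecker_delta y = form_prod m n kronecker_delta x"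
    using m A y by (intro uncorrelated_preserves_delta_form) auto
  show "(\<Sum>k<n. \<Prod>j<m. y j $ k) = (\<Sum>k<n. \<Prod>j<m. x j $ k)"
    using forms m by (simp add: form_prod_kronecker_delta)
next
  fix n :: nat and A :: "nat \<Rightarrow> complex mat" and x y :: "nat \<Rightarrow> complex vec"
  assume A: "A 1 \<in> carrier_mat n n" "A 2 \<in> carrier_mat n n" "inverts_mat (A 1) (A 2)"
    and y: "\<forall>k<n. y 1 $ k * y 0 $ k =
      form_prod 2 n (outer_prod 2 (\<lambda>t. hypermatrix_of_mat (A t)) k) x"
  have "(\<Prod>j<2. y j $ k) = y 1 $ k * y 0 $ k" for k
    by (simp add: numeral_2_eq_2 mult.commute)
  then show "form_prod 2 n kronecker_delta y = form_prod 2 n kronecker_delta x"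
    using y uncorrelated_hypermatrix_of_inverse_pair[OF A]
    by (intro uncorrelated_preserves_delta_form) auto
qed

end
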